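(* Let $G$ and $H$ be two at most countable groups with $\mathrm{Con}^*_c(G)=\mathrm{Con}^*_c(H)$. Then $H$ admits a normal subgroup $F$ such that $G\cong H/F$. If in addition $G$ is a $Q$-group, then $G\cong H$.
   Context: A group $G$ is a $Q$-group (Hopfian) if every epimorphism $G\to G$ is an isomorphism. Partitions consist of nonempty pairwise disjoint sets covering the given set, and are indexed. Finite configurations. Let $G$ be a group, $\mathcal E=\{E_1,\dots,E_m\}$ a finite indexed partition of $G$, and $\mathfrak g=(g_1,\dots,g_n)$ a finite ordered tuple of elements of $G$. An $(n+1)$-tuple $C=(C_0,C_1,\dots,C_n)$ of integers in $\{1,\dots,m\}$ is a configuration corresponding to $(\mathfrak g,\mathcal E)$ if there exists $x\in E_{C_0}$ such that $g_jx\in E_{C_j}$ for each $j\in\{1,\dots,n\}$. The set of all such configurations is denoted $\mathrm{Con}(\mathfrak g,\mathcal E)$. $\mathrm{Con}^*(G)$ is the family of all sets $\mathrm{Con}(\mathfrak g,\mathcal E)$, where $\mathcal E$ ranges over all finite partitions of $G$ and $\mathfrak g$ ranges over all finite tuples (of any length) whose entries generate $G$. Countable-configurations. Let $G$ be a countably infinite group, $\mathfrak g=(g_i)_{i=1}^\infty$ a sequence of elements of $G$ (repetitions allowed) and $\mathcal E=\{E_i\}_{i=1}^\infty$ an infinite partition of $G$ indexed by the positive integers. A countable-configuration related to $(\mathfrak g,\mathcal E)$ is a sequence $C=(C_0,C_1,\dots)$ of positive integers such that for some $x\in E_{C_0}$ one has $g_ix\in E_{C_i}$ for all $i\geq 1$.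 The set of all such sequences is denoted $\mathrm{Con}_c(\mathfrak g,\mathcal E)$. $\mathrm{Con}^*_c(G)$ is the family of all sets $\mathrm{Con}_c(\mathfrak g,\mathcal E)$, where $\mathcal E$ ranges over all such infinite partitions of $G$ and $\mathfrak g$ ranges over all sequences in $G$ whose terms generate $G$. Convention: if $G$ is finite, $\mathrm{Con}^*_c(G):=\mathrm{Con}^*(G)$. *)

theory Defs
  imports "HOL-Algebra.Generated_Groups" "HOL-Library.Disjoint_Sets" "HOL-Library.Countable_Set"
begin

definition Q_group :: "('a, 'c) monoid_scheme \<Rightarrow> bool" where
  "Q_group G \<longleftrightarrow> group G \<and> epi G G \<subseteq> iso G G"

definition indexed_partition :: "(nat \<Rightarrow> 'a set) \<Rightarrow> nat set \<Rightarrow> 'a set \<Rightarrow> bool" where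
  "indexed_partition E I A \<longleftrightarrow>
     (\<forall>i\<in>I. E i \<noteq> {}) \<and> disjoint_family_on E I \<and> (\<Union>i\<in>I. E i) = A"

(* The tuple (g_1, ..., g_n) is a list gs, so g_j is gs ! (j - 1); the configuration
   (C_0, ..., C_n) is a list C of length n + 1, so C_j is C ! j. *)
definition Con ::
  "('a, 'c) monoid_scheme \<Rightarrow> 'a list \<Rightarrow> nat \<Rightarrow> (nat \<Rightarrow> 'a set) \<Rightarrow> nat list set" where
  "Con G gs m E =
     {C. length C = length gs + 1 \<and> set C \<subseteq> {1..m} \<and>
         (\<exists>x\<in>E (C ! 0). \<forall>j\<in>{1..length gs}. gs ! (j - 1) \<otimes>\<^bsub>G\<^esub> x \<in> E (C ! j))}"

definition Con_star :: "('a, 'c) monoid_scheme \<Rightarrow> nat list set set" where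
  "Con_star G =
     {Con G gs m E | gs m E.
        set gs \<subseteq> carrier G \<and> generate G (set gs) = carrier G \<and>
        indexed_partition E {1..m} (carrier G)}"

(* The sequence of group elements is g 1, g 2, ...; the value g 0 plays no role.
   A configuration is C 0, C 1, ..., all of whose terms are positive. *)
definition Con_c ::
  "('a, 'c) monoid_scheme \<Rightarrow> (nat \<Rightarrow> 'a) \<Rightarrow> (nat \<Rightarrow> 'a set) \<Rightarrow> (nat \<Rightarrow> nat) set" where
  "Con_c G g E =
     {C. (\<forall>i. C i \<ge> 1) \<and>
         (\<exists>x\<in>E (C 0). \<forall>i\<ge>1. g i \<otimes>\<^bsub>G\<^esub> x \<in> E (C i))}"

(* Finite tuples and infinite sequences are different objects, so the two kinds of
   configuration sets are kept apart by the summands of a sum type; a family coming from a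
   finite group is therefore never equal to one coming from an infinite group. *)
definition Con_c_star ::
  "('a, 'c) monoid_scheme \<Rightarrow> (nat list set + (nat \<Rightarrow> nat) set) set" where
  "Con_c_star G =
     (if finite (carrier G) then Inl ` Con_star G
      else Inr ` {Con_c G g E | g E.
        g ` {1..} \<subseteq> carrier G \<and> generate G (g ` {1..}) = carrier G \<and>
        indexed_partition E {1..} (carrier G)})"

end

theory Submission
  imports Defs
begin

text \<open>
  A configuration set is the image of the group under the map that sends \<open>x\<close> to the
  sequence of cell indices of \<open>x, g\<^sub>1 x, g\<^sub>2 x, \<dots>\<close>. Partition \<open>G\<close> into
  singletons: then the cell index of \<open>x\<close> determines \<open>x\<close>, so the configuration set records
  how the generators \<open>g\<^sub>j\<close> act by left translation. If \<open>H\<close> has the same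
  configuration set, for some \<open>h\<^sub>j\<close> and some partition of \<open>H\<close>, then sending
  \<open>y \<in> H\<close> to the unique \<open>x \<in> G\<close> with the same configuration gives a surjection
  \<open>f\<close> with \<open>f (h\<^sub>j y) = g\<^sub>j f y\<close> (\<open>same_configurations_imp_epi\<close>). As the
  \<open>h\<^sub>j\<close> generate \<open>H\<close>, every left translation of \<open>H\<close> is carried by \<open>f\<close> to a left
  translation of \<open>G\<close>, and this assignment of translations is an epimorphism from \<open>H\<close>
  to \<open>G\<close> (\<open>equivariant_surjection_imp_epi\<close>). The first isomorphism theorem gives the
  first claim.

  The hypothesis is symmetric, so there is also an epimorphism from \<open>G\<close> to \<open>H\<close>. If \<open>G\<close>
  is Hopfian, the composite \<open>G \<rightarrow> H \<rightarrow> G\<close> is injective, hence so is its first factor,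
  which is therefore an isomorphism.
\<close>

section \<open>Equivariant surjections between groups\<close>

text \<open>
  The elements of \<open>H\<close> whose left translation is intertwined by \<open>f\<close> with some left
  translation of \<open>G\<close> form a subgroup: for the inverse of such an element, apply the
  intertwining relation at the inversely translated point. So that subgroup is all of \<open>H\<close>
  once it contains generators. The translation of \<open>G\<close> belonging to \<open>k\<close> is read off at the
  point \<open>\<one>\<close>, where \<open>f\<close> need not take the value \<open>\<one>\<close>: it is multiplication by
  \<open>f k (f \<one>)\<^sup>-\<^sup>1\<close>.
\<close>

lemma equivariant_surjection_imp_epi:
  assumes "group G" and "group H"
    and f_onto: "f ` carrier H = carrier G"
    and g: "\<And>j. j \<in> J \<Longrightarrow> g j \<in> carrier G"
    and h: "\<And>j. j \<in> J \<Longrightarrow> h j \<in> carrier H"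
    and gen: "generate H (h ` J) = carrier H"
    and equivariant: "\<And>j y. j \<in> J \<Longrightarrow> y \<in> carrier H \<Longrightarrow> f (h j \<otimes>\<^bsub>H\<^esub> y) = g j \<otimes>\<^bsub>G\<^esub> f y"
  shows "\<exists>\<phi>. \<phi> \<in> epi H G"
proof -
  interpret G: group G by fact
  interpret H: group H by fact
  have f_in: "f y \<in> carrier G" if "y \<in> carrier H" for y
    using f_onto that by blast
  have translation: "\<exists>a\<in>carrier G. \<forall>y\<in>carrier H. f (k \<otimes>\<^bsub>H\<^esub> y) = a \<otimes>\<^bsub>G\<^esub> f y"
    if "k \<in> generate H (h ` J)" for k
    using that
  proof (induction rule: generate.induct)
    case one
    show ?case using f_in by (intro bexI[of _ "\<one>\<^bsub>G\<^esub>"]) auto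
  next
    case (incl k)
    then show ?case using g equivariant by blast
  next
    case (inv k)
    then obtain j where j: "j \<in> J" "k = h j" by blast
    have "f (inv\<^bsub>H\<^esub> k \<otimes>\<^bsub>H\<^esub> y) = inv\<^bsub>G\<^esub> (g j) \<otimes>\<^bsub>G\<^esub> f y" if y: "y \<in> carrier H" for y
    proof -
      have "f y = f (h j \<otimes>\<^bsub>H\<^esub> (inv\<^bsub>H\<^esub> k \<otimes>\<^bsub>H\<^esub> y))"
        using h j y by (simp add: H.inv_solve_left' flip: H.m_assoc)
      also have "\<dots> = g j \<otimes>\<^bsub>G\<^esub> f (inv\<^bsub>H\<^esub> k \<otimes>\<^bsub>H\<^esub> y)"
        using h j y by (intro equivariant) auto
      finally show ?thesis
        using g h j y f_in by (simp add: G.inv_solve_left)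
    qed
    then show ?case using g j by blast
  next
    case (eng k l)
    then obtain a b where
      a: "a \<in> carrier G" "\<forall>y\<in>carrier H. f (k \<otimes>\<^bsub>H\<^esub> y) = a \<otimes>\<^bsub>G\<^esub> f y" and
      b: "b \<in> carrier G" "\<forall>y\<in>carrier H. f (l \<otimes>\<^bsub>H\<^esub> y) = b \<otimes>\<^bsub>G\<^esub> f y" by blast
    have kl: "k \<in> carrier H" "l \<in> carrier H" using eng gen by auto
    show ?case
      using a b kl f_in by (intro bexI[of _ "a \<otimes>\<^bsub>G\<^esub> b"]) (auto simp: H.m_assoc G.m_assoc)
  qed
  define \<phi> where "\<phi> k = f k \<otimes>\<^bsub>G\<^esub> inv\<^bsub>G\<^esub> (f \<one>\<^bsub>H\<^esub>)" for k
  have f1: "f \<one>\<^bsub>H\<^esub> \<in> carrier G" by (simp add: f_in)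
  have \<phi>_in: "\<phi> k \<in> carrier G" if "k \<in> carrier H" for k
    using that f1 f_in by (simp add: \<phi>_def)
  have f_eq: "f (k \<otimes>\<^bsub>H\<^esub> y) = \<phi> k \<otimes>\<^bsub>G\<^esub> f y" if k: "k \<in> carrier H" and y: "y \<in> carrier H" for k y
  proof -
    obtain a where a: "a \<in> carrier G" "\<forall>y\<in>carrier H. f (k \<otimes>\<^bsub>H\<^esub> y) = a \<otimes>\<^bsub>G\<^esub> f y"
      using translation k gen by blast
    from a(2) have "f k = a \<otimes>\<^bsub>G\<^esub> f \<one>\<^bsub>H\<^esub>" using k by (metis H.one_closed H.r_one)
    then have "\<phi> k = a" using a(1) f1 by (simp add: \<phi>_def G.m_assoc)
    then show ?thesis using a y by blast
  qed
  have "\<phi> (k \<otimes>\<^bsub>H\<^esub> l) = \<phi> k \<otimes>\<^bsub>G\<^esub> \<phi> l" if "k \<in> carrier H" "l \<in> carrier H" for k l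
  proof -
    have "\<phi> (k \<otimes>\<^bsub>H\<^esub> l) = \<phi> k \<otimes>\<^bsub>G\<^esub> f l \<otimes>\<^bsub>G\<^esub> inv\<^bsub>G\<^esub> (f \<one>\<^bsub>H\<^esub>)"
      using f_eq that by (simp add: \<phi>_def[of "k \<otimes>\<^bsub>H\<^esub> l"])
    also have "\<dots> = \<phi> k \<otimes>\<^bsub>G\<^esub> \<phi> l"
      using that f1 f_in \<phi>_in by (simp add: \<phi>_def[of l] G.m_assoc)
    finally show ?thesis .
  qed
  then have hom: "\<phi> \<in> hom H G" using \<phi>_in by (auto simp: hom_def)
  have "a \<in> \<phi> ` carrier H" if a: "a \<in> carrier G" for a
  proof -
    have "a \<otimes>\<^bsub>G\<^esub> f \<one>\<^bsub>H\<^esub> \<in> f ` carrier H" using a f1 by (simp add: f_onto)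
    then obtain k where k: "k \<in> carrier H" "f k = a \<otimes>\<^bsub>G\<^esub> f \<one>\<^bsub>H\<^esub>" by force
    then have "\<phi> k = a" using a f1 by (simp add: \<phi>_def G.m_assoc)
    then show ?thesis using k by blast
  qed
  then have "\<phi> ` carrier H = carrier G" using \<phi>_in by blast
  then show ?thesis using hom by (auto simp: epi_def)
qed

text \<open>
  Here \<open>c\<close> and \<open>d\<close> stand for the cell indices of partitions of \<open>G\<close> and \<open>H\<close>, and the last two
  hypotheses say that the same configurations occur in both. Stating this without sequences
  treats finite tuples and infinite sequences of generators alike. Injectivity of \<open>c\<close> (the
  cells in \<open>G\<close> are singletons) makes the point of \<open>G\<close> that realises a given configuration
  unique; the same uniqueness at \<open>h j \<otimes> y\<close> is what makes the matching equivariant.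
\<close>

lemma same_configurations_imp_epi:
  fixes c :: "'a \<Rightarrow> 'i" and d :: "'b \<Rightarrow> 'i"
  assumes "group G" and "group H"
    and g: "\<And>j. j \<in> J \<Longrightarrow> g j \<in> carrier G"
    and h: "\<And>j. j \<in> J \<Longrightarrow> h j \<in> carrier H"
    and gen: "generate H (h ` J) = carrier H"
    and inj: "inj_on c (carrier G)"
    and H_to_G: "\<And>y. y \<in> carrier H \<Longrightarrow>
      \<exists>x\<in>carrier G. c x = d y \<and> (\<forall>j\<in>J. c (g j \<otimes>\<^bsub>G\<^esub> x) = d (h j \<otimes>\<^bsub>H\<^esub> y))"
    and G_to_H: "\<And>x. x \<in> carrier G \<Longrightarrow>
      \<exists>y\<in>carrier H. c x = d y \<and> (\<forall>j\<in>J. c (g j \<otimes>\<^bsub>G\<^esub> x) = d (h j \<otimes>\<^bsub>H\<^esub> y))"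
  shows "\<exists>\<phi>. \<phi> \<in> epi H G"
proof -
  interpret G: group G by fact
  interpret H: group H by fact
  obtain f where f: "\<And>y. y \<in> carrier H \<Longrightarrow>
      f y \<in> carrier G \<and> c (f y) = d y \<and> (\<forall>j\<in>J. c (g j \<otimes>\<^bsub>G\<^esub> f y) = d (h j \<otimes>\<^bsub>H\<^esub> y))"
    using H_to_G by metis
  have f_unique: "f y = x" if "y \<in> carrier H" "x \<in> carrier G" "c x = d y" for x y
    using inj_onD[OF inj, of "f y" x] f[OF that(1)] that by simp
  have "x \<in> f ` carrier H" if "x \<in> carrier G" for x
    using G_to_H[OF that] f_unique that by blast
  then have "f ` carrier H = carrier G" using f by blast
  moreover have "f (h j \<otimes>\<^bsub>H\<^esub> y) = g j \<otimes>\<^bsub>G\<^esub> f y" if "j \<in> J" "y \<in> carrier H" for j y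
    using f[OF that(2)] that g h by (intro f_unique) auto
  ultimately show ?thesis
    using equivariant_surjection_imp_epi[of G H f J g h] assms(1,2) g h gen by blast
qed

section \<open>Configuration sets as images of the group\<close>

definition cell :: "(nat \<Rightarrow> 'a set) \<Rightarrow> nat set \<Rightarrow> 'a \<Rightarrow> nat" where
  "cell E I x = (THE i. i \<in> I \<and> x \<in> E i)"

lemma cell_eqI:
  assumes "indexed_partition E I A" "i \<in> I" "x \<in> E i"
  shows "cell E I x = i"
  unfolding cell_def
  using assms by (intro the_equality) (auto simp: indexed_partition_def disjoint_family_on_def)

lemma cell_mem:
  assumes "indexed_partition E I A" "x \<in> A"
  shows "cell E I x \<in> I" and "x \<in> E (cell E I x)"
proof -
  obtain i where "i \<in> I" "x \<in> E i" using assms by (auto simp: indexed_partition_def)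
  then show "cell E I x \<in> I" and "x \<in> E (cell E I x)" using cell_eqI[OF assms(1)] by auto
qed

lemma indexed_partition_subset:
  assumes "indexed_partition E I A" "i \<in> I"
  shows "E i \<subseteq> A"
  using assms by (auto simp: indexed_partition_def)

lemma singleton_partition:
  assumes "bij_betw e I A"
  shows "indexed_partition (\<lambda>i. {e i}) I A" and "inj_on (cell (\<lambda>i. {e i}) I) A"
proof -
  show part: "indexed_partition (\<lambda>i. {e i}) I A"
    using assms
    by (auto simp: indexed_partition_def disjoint_family_on_def bij_betw_def inj_on_def)
  show "inj_on (cell (\<lambda>i. {e i}) I) A"
    using cell_mem(2)[OF part] by (intro inj_onI) (metis singletonD)
qed

lemma Con_eq_image:
  assumes "group G" and gs: "set gs \<subseteq> carrier G"
    and part: "indexed_partition E {1..m} (carrier G)"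
  shows "Con G gs m E =
    (\<lambda>x. cell E {1..m} x # map (\<lambda>a. cell E {1..m} (a \<otimes>\<^bsub>G\<^esub> x)) gs) ` carrier G"
    (is "_ = ?conf ` _")
proof (intro equalityI subsetI)
  fix C assume "C \<in> Con G gs m E"
  then obtain x where len: "length C = length gs + 1" and C: "set C \<subseteq> {1..m}"
    and x: "x \<in> E (C ! 0)" and gx: "\<forall>j\<in>{1..length gs}. gs ! (j - 1) \<otimes>\<^bsub>G\<^esub> x \<in> E (C ! j)"
    by (auto simp: Con_def)
  have C_in: "C ! j \<in> {1..m}" if "j < length C" for j using C that nth_mem by blast
  have "C = ?conf x"
  proof (rule nth_equalityI)
    fix j assume j: "j < length C"
    show "C ! j = ?conf x ! j"
    proof (cases j)
      case 0
      then show ?thesis using cell_eqI[OF part C_in[OF j], of x] x by simp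
    next
      case (Suc i)
      then show ?thesis
        using cell_eqI[OF part C_in[OF j], of "gs ! i \<otimes>\<^bsub>G\<^esub> x"] gx j len by force
    qed
  qed (simp add: len)
  moreover have "x \<in> carrier G"
    using indexed_partition_subset[OF part C_in[of 0]] x len by auto
  ultimately show "C \<in> ?conf ` carrier G" by blast
next
  interpret group G by fact
  fix C assume "C \<in> ?conf ` carrier G"
  then obtain x where x: "x \<in> carrier G" and C: "C = ?conf x" by blast
  have gx: "a \<otimes>\<^bsub>G\<^esub> x \<in> carrier G" if "a \<in> set gs" for a using that gs x by blast
  have "set C \<subseteq> {1..m}"
    using cell_mem(1)[OF part] x gx unfolding C by auto
  moreover have "gs ! (j - 1) \<otimes>\<^bsub>G\<^esub> x \<in> E (C ! j)" if "j \<in> {1..length gs}" for j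
    using cell_mem(2)[OF part gx] that by (auto simp: C nth_Cons')
  moreover have "x \<in> E (C ! 0)" using cell_mem(2)[OF part x] by (simp add: C)
  moreover have "length C = length gs + 1" by (simp add: C)
  ultimately show "C \<in> Con G gs m E" unfolding Con_def by blast
qed

lemma Con_c_eq_image:
  assumes "group G" and g: "g ` {1..} \<subseteq> carrier G"
    and part: "indexed_partition E {1..} (carrier G)"
  shows "Con_c G g E =
    (\<lambda>x i. cell E {1..} (if i = 0 then x else g i \<otimes>\<^bsub>G\<^esub> x)) ` carrier G"
    (is "_ = ?conf ` _")
proof (intro equalityI subsetI)
  fix C assume "C \<in> Con_c G g E"
  then obtain x where C: "\<And>i. C i \<ge> 1"
    and x: "x \<in> E (C 0)" and gx: "\<forall>i\<ge>1. g i \<otimes>\<^bsub>G\<^esub> x \<in> E (C i)"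
    by (auto simp: Con_c_def)
  have "C = ?conf x"
  proof
    fix i
    show "C i = ?conf x i"
      using cell_eqI[OF part, of "C i"] C x gx by (cases "i = 0") auto
  qed
  moreover have "x \<in> carrier G"
    using indexed_partition_subset[OF part, of "C 0"] x C by auto
  ultimately show "C \<in> ?conf ` carrier G" by blast
next
  interpret group G by fact
  fix C assume "C \<in> ?conf ` carrier G"
  then obtain x where x: "x \<in> carrier G" and C: "C = ?conf x" by blast
  have gx: "(if i = 0 then x else g i \<otimes>\<^bsub>G\<^esub> x) \<in> carrier G" for i
    using g x by (auto simp: image_subset_iff)
  have pos: "C i \<ge> 1" for i using cell_mem(1)[OF part gx] by (simp add: C)
  have mem: "(if i = 0 then x else g i \<otimes>\<^bsub>G\<^esub> x) \<in> E (C i)" for i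
    using cell_mem(2)[OF part gx] by (simp add: C)
  have "x \<in> E (C 0)" using mem[of 0] by simp
  moreover have "\<forall>i\<ge>1. g i \<otimes>\<^bsub>G\<^esub> x \<in> E (C i)"
    using mem by (metis not_one_le_zero)
  ultimately show "C \<in> Con_c G g E"
    using pos unfolding Con_c_def by blast
qed

section \<open>Epimorphisms from equality of configuration families\<close>

lemma (in group) generate_carrier: "generate G (carrier G) = carrier G"
  by (rule equalityI[OF generate_incl[OF subset_refl] subsetI[OF generate.incl]])

text \<open>
  One member of the family of \<open>G\<close> suffices: the one in which the partition consists of
  singletons and every element of \<open>G\<close> is listed as a generator. The summand of the sum type
  in which it lies forces \<open>H\<close> to be finite exactly when \<open>G\<close> is.
\<close>

lemma Con_c_star_eq_imp_epi:
  fixes G :: "('a, 'c) monoid_scheme" and H :: "('b, 'd) monoid_scheme"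
  assumes "group G" and "group H" and "countable (carrier G)"
    and eq: "Con_c_star G = Con_c_star H"
  shows "\<exists>\<phi>. \<phi> \<in> epi H G"
proof (cases "finite (carrier G)")
  case True
  define m where "m = card (carrier G)"
  obtain e where e: "bij_betw e {1..m} (carrier G)"
    unfolding m_def using ex_bij_betw_nat_finite_1[OF True] by blast
  obtain gs where gs: "set gs = carrier G" using finite_list[OF True] by blast
  define E where "E = (\<lambda>i. {e i})"
  have part: "indexed_partition E {1..m} (carrier G)"
    and inj: "inj_on (cell E {1..m}) (carrier G)"
    using singleton_partition[OF e] by (simp_all add: E_def)
  have "Con G gs m E \<in> Con_star G"
    using gs part group.generate_carrier[OF \<open>group G\<close>] unfolding Con_star_def by force
  then have "Inl (Con G gs m E) \<in> Con_c_star H"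
    unfolding eq[symmetric] using True by (simp add: Con_c_star_def)
  then have "Con G gs m E \<in> Con_star H"
    by (auto simp: Con_c_star_def split: if_splits)
  then obtain hs n D where hs: "set hs \<subseteq> carrier H" "generate H (set hs) = carrier H"
    and partH: "indexed_partition D {1..n} (carrier H)"
    and Con: "Con G gs m E = Con H hs n D"
    by (auto simp: Con_star_def)
  let ?c = "cell E {1..m}" and ?d = "cell D {1..n}"
  have images: "(\<lambda>x. ?c x # map (\<lambda>a. ?c (a \<otimes>\<^bsub>G\<^esub> x)) gs) ` carrier G =
      (\<lambda>y. ?d y # map (\<lambda>a. ?d (a \<otimes>\<^bsub>H\<^esub> y)) hs) ` carrier H"
    using Con Con_eq_image[OF \<open>group G\<close> _ part, of gs] Con_eq_image[OF \<open>group H\<close> hs(1) partH] gs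
    by simp
  \<comment> \<open>The length of a configuration determines the length of the tuple.\<close>
  have "\<one>\<^bsub>G\<^esub> \<in> carrier G" using \<open>group G\<close> by (simp add: group.is_monoid)
  then obtain y where "?c \<one>\<^bsub>G\<^esub> # map (\<lambda>a. ?c (a \<otimes>\<^bsub>G\<^esub> \<one>\<^bsub>G\<^esub>)) gs =
      ?d y # map (\<lambda>a. ?d (a \<otimes>\<^bsub>H\<^esub> y)) hs"
    using equalityD1[OF images] by blast
  then have len: "length gs = length hs" by (auto dest: map_eq_imp_length_eq)
  have same: "?c (gs ! j \<otimes>\<^bsub>G\<^esub> x) = ?d (hs ! j \<otimes>\<^bsub>H\<^esub> y)"
    if "map (\<lambda>a. ?c (a \<otimes>\<^bsub>G\<^esub> x)) gs = map (\<lambda>a. ?d (a \<otimes>\<^bsub>H\<^esub> y)) hs" "j < length gs" for x y j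
    using arg_cong[OF that(1), of "\<lambda>xs. xs ! j"] that(2) len by simp
  show ?thesis
  proof (rule same_configurations_imp_epi[where J = "{..<length gs}" and g = "(!) gs"
        and h = "(!) hs" and c = ?c and d = ?d])
    show "generate H ((!) hs ` {..<length gs}) = carrier H"
      using hs(2) len nth_image[of "length hs" hs] by (simp add: atLeast0LessThan)
    show "gs ! j \<in> carrier G" if "j \<in> {..<length gs}" for j using that gs nth_mem by blast
    show "hs ! j \<in> carrier H" if "j \<in> {..<length gs}" for j
      using that hs(1) len nth_mem by auto
  next
    fix y assume "y \<in> carrier H"
    then obtain x where "x \<in> carrier G" "?d y # map (\<lambda>a. ?d (a \<otimes>\<^bsub>H\<^esub> y)) hs =
        ?c x # map (\<lambda>a. ?c (a \<otimes>\<^bsub>G\<^esub> x)) gs"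
      using equalityD2[OF images] by blast
    then show "\<exists>x\<in>carrier G. ?c x = ?d y \<and>
        (\<forall>j\<in>{..<length gs}. ?c (gs ! j \<otimes>\<^bsub>G\<^esub> x) = ?d (hs ! j \<otimes>\<^bsub>H\<^esub> y))"
      using same by (intro bexI[of _ x]) auto
  next
    fix x assume "x \<in> carrier G"
    then obtain y where "y \<in> carrier H" "?c x # map (\<lambda>a. ?c (a \<otimes>\<^bsub>G\<^esub> x)) gs =
        ?d y # map (\<lambda>a. ?d (a \<otimes>\<^bsub>H\<^esub> y)) hs"
      using equalityD1[OF images] by blast
    then show "\<exists>y\<in>carrier H. ?c x = ?d y \<and>
        (\<forall>j\<in>{..<length gs}. ?c (gs ! j \<otimes>\<^bsub>G\<^esub> x) = ?d (hs ! j \<otimes>\<^bsub>H\<^esub> y))"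
      using same by (intro bexI[of _ y]) auto
  qed (use assms inj in auto)
next
  case False
  \<comment> \<open>Cells and generators are numbered from 1, but \<open>from_nat_into\<close> enumerates from 0.\<close>
  have shift: "bij_betw (\<lambda>i. i - 1) {1::nat..} UNIV"
    by (rule bij_betw_byWitness[where f' = Suc]) auto
  obtain e :: "nat \<Rightarrow> 'a" where e: "bij_betw e {1..} (carrier G)"
    using bij_betw_trans[OF shift bij_betw_from_nat_into[OF \<open>countable (carrier G)\<close> False]] ..
  define E where "E = (\<lambda>i. {e i})"
  have part: "indexed_partition E {1..} (carrier G)"
    and inj: "inj_on (cell E {1..}) (carrier G)"
    using singleton_partition[OF e] by (simp_all add: E_def)
  have e_onto: "e ` {1..} = carrier G" using e by (simp add: bij_betw_def)
  have "Inr (Con_c G e E) \<in> Con_c_star G"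
  proof -
    have "e ` {1..} \<subseteq> carrier G \<and> generate G (e ` {1..}) = carrier G \<and>
        indexed_partition E {1..} (carrier G)"
      using e_onto part group.generate_carrier[OF \<open>group G\<close>] by simp
    then show ?thesis
      unfolding Con_c_star_def if_not_P[OF False] by (intro imageI CollectI exI conjI refl) auto
  qed
  then have "Inr (Con_c G e E) \<in> Con_c_star H" using eq by simp
  then obtain h D where h: "h ` {1..} \<subseteq> carrier H" "generate H (h ` {1..}) = carrier H"
    and partH: "indexed_partition D {1..} (carrier H)"
    and Con: "Con_c G e E = Con_c H h D"
    by (auto simp: Con_c_star_def split: if_splits)
  let ?c = "cell E {1..}" and ?d = "cell D {1..}"
  define confG where "confG x i = ?c (if i = 0 then x else e i \<otimes>\<^bsub>G\<^esub> x)" for x i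
  define confH where "confH y i = ?d (if i = 0 then y else h i \<otimes>\<^bsub>H\<^esub> y)" for y i
  have images: "confG ` carrier G = confH ` carrier H"
    using Con Con_c_eq_image[OF \<open>group G\<close> _ part, of e] Con_c_eq_image[OF \<open>group H\<close> h(1) partH]
      e_onto by (simp add: confG_def[abs_def] confH_def[abs_def])
  have same: "?c x = ?d y \<and> (\<forall>j\<in>{1..}. ?c (e j \<otimes>\<^bsub>G\<^esub> x) = ?d (h j \<otimes>\<^bsub>H\<^esub> y))"
    if "confG x = confH y" for x y
  proof (intro conjI ballI)
    show "?c x = ?d y" using fun_cong[OF that, of 0] by (simp add: confG_def confH_def)
    show "?c (e j \<otimes>\<^bsub>G\<^esub> x) = ?d (h j \<otimes>\<^bsub>H\<^esub> y)" if "j \<in> {1..}" for j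
      using fun_cong[OF \<open>confG x = confH y\<close>, of j] that
      by (simp add: confG_def confH_def)
  qed
  show ?thesis
  proof (rule same_configurations_imp_epi[where J = "{1..}" and g = e and h = h
        and c = ?c and d = ?d])
    fix y assume "y \<in> carrier H"
    then obtain x where "x \<in> carrier G" "confG x = confH y"
      using equalityD2[OF images] by (metis imageE imageI subsetD)
    then show "\<exists>x\<in>carrier G. ?c x = ?d y \<and>
        (\<forall>j\<in>{1..}. ?c (e j \<otimes>\<^bsub>G\<^esub> x) = ?d (h j \<otimes>\<^bsub>H\<^esub> y))"
      using same by blast
  next
    fix x assume "x \<in> carrier G"
    then obtain y where "y \<in> carrier H" "confG x = confH y"
      using equalityD1[OF images] by (metis imageE imageI subsetD)
    then show "\<exists>y\<in>carrier H. ?c x = ?d y \<and>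
        (\<forall>j\<in>{1..}. ?c (e j \<otimes>\<^bsub>G\<^esub> x) = ?d (h j \<otimes>\<^bsub>H\<^esub> y))"
      using same by blast
  qed (use assms inj e_onto h in auto)
qed

section \<open>Quotients and Hopfian groups\<close>

lemma epi_imp_iso_quotient:
  assumes "group G" and "group H" and "\<phi> \<in> epi H G"
  shows "\<exists>F. F \<lhd> H \<and> G \<cong> H Mod F"
proof -
  interpret group_hom H G \<phi>
    using assms by (intro group_hom.intro group_hom_axioms.intro) (auto simp: epi_def)
  have "H Mod kernel H G \<phi> \<cong> G"
    using assms(3) by (simp add: FactGroup_iso epi_def)
  then have "G \<cong> H Mod kernel H G \<phi>"
    by (rule group.iso_sym[OF normal.factorgroup_is_group[OF normal_kernel]])
  then show ?thesis using normal_kernel by blast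
qed

lemma Q_group_mutual_epi_imp_iso:
  assumes "Q_group G" and "\<phi> \<in> epi H G" and "\<psi> \<in> epi G H"
  shows "G \<cong> H"
proof -
  have "\<phi> \<circ> \<psi> \<in> epi G G"
    using assms(2,3) by (auto simp: epi_def intro: hom_compose simp flip: image_image)
  then have "\<phi> \<circ> \<psi> \<in> iso G G" using assms(1) by (auto simp: Q_group_def)
  then have "inj_on (\<phi> \<circ> \<psi>) (carrier G)" by (simp add: iso_def bij_betw_def)
  then have "inj_on \<psi> (carrier G)" by (rule inj_on_imageI2)
  then have "\<psi> \<in> iso G H" using assms(3) by (simp add: epi_def iso_def bij_betw_def)
  then show ?thesis by (auto simp: is_iso_def)
qed

theorem theorem2p3:
  fixes G :: "('a, 'c) monoid_scheme" and H :: "('b, 'd) monoid_scheme"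
  assumes "group G" and "group H"
    and "countable (carrier G)" and "countable (carrier H)"
    and "Con_c_star G = Con_c_star H"
  shows "(\<exists>F. F \<lhd> H \<and> G \<cong> H Mod F) \<and> (Q_group G \<longrightarrow> G \<cong> H)"
proof -
  obtain \<phi> where \<phi>: "\<phi> \<in> epi H G"
    using Con_c_star_eq_imp_epi[OF assms(1,2,3,5)] by blast
  obtain \<psi> where \<psi>: "\<psi> \<in> epi G H"
    using Con_c_star_eq_imp_epi[OF assms(2,1,4) assms(5)[symmetric]] by blast
  show ?thesis
    using epi_imp_iso_quotient[OF assms(1,2) \<phi>] Q_group_mutual_epi_imp_iso[OF _ \<phi> \<psi>] by blast
qed

end
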